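(* Let $X$ be a connected, locally connected, Hausdorff and locally compact topological space. Let $(Y_i)$ be a countable collection of closed subsets of $X$ which cover $X$. If the intersection $Y_i\cap Y_j$ is small for all $i\neq j$, then $Y_i=X$ for some $i$.
   Context: A subset $A\subset X$ locally disconnects if there is a connected open set $U\subset X$ such that $U\setminus A$ is not connected. A subset $Z\subset X$ is small if it is closed, has empty interior, and does not locally disconnect. (The empty set is small.) *)

theory Defs
  imports "HOL-Analysis.Analysis"
begin

definition locally_disconnects :: "'a topology \<Rightarrow> 'a set \<Rightarrow> bool" where
  "locally_disconnects X A \<longleftrightarrow>
     (\<exists>U. openin X U \<and> connectedin X U \<and> \<not> connectedin X (U - A))"

(* The library counts the empty set as connected. Under the opposite convention smallness is
   unchanged: a set with empty interior contains no nonempty open set U. *)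
definition small_in :: "'a topology \<Rightarrow> 'a set \<Rightarrow> bool" where
  "small_in X Z \<longleftrightarrow>
     closedin X Z \<and> X interior_of Z = {} \<and> \<not> locally_disconnects X Z"

end

theory Submission
  imports Defs
begin

text \<open>By the Baire property, the interiors of the sets \<open>Y i\<close> are dense. They are pairwise disjoint,
  so by connectedness we are done if they cover \<open>X\<close>. Otherwise, apply the Baire property to the
  complement \<open>F\<close> of their union: some connected open \<open>U\<close> meets \<open>F\<close> with \<open>U \<inter> F \<subseteq> Y i\<close>. By density
  \<open>U\<close> meets \<open>interior (Y j) - Y i\<close> for some \<open>j \<noteq> i\<close>. The frontier of \<open>interior (Y j)\<close> in \<open>U\<close> lies in
  \<open>F \<inter> Y j\<close>, hence in \<open>Y i \<inter> Y j\<close>, so removing \<open>Y i \<inter> Y j\<close> disconnects \<open>U\<close>.\<close>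

text \<open>Baire category in the locally compact Hausdorff subspace \<open>F\<close>: the countably
  many closed traces \<open>F \<inter> Y i\<close> cannot all have empty relative interior. Local
  compactness is asked of \<open>F\<close> itself, so that the lemma serves for open as well as
  closed \<open>F\<close>.\<close>

lemma countable_closed_cover_relative_interior:
  assumes "Hausdorff_space X" and "locally_compact_space (subtopology X F)"
    and "F \<noteq> {}" and "F \<subseteq> topspace X" and "countable I"
    and closed: "\<And>i. i \<in> I \<Longrightarrow> closedin X (Y i)"
    and cover: "F \<subseteq> (\<Union>i\<in>I. Y i)"
  obtains i W where "i \<in> I" and "openin X W" and "W \<inter> F \<noteq> {}" and "W \<inter> F \<subseteq> Y i"
proof -
  let ?S = "subtopology X F"
  have "\<exists>i\<in>I. ?S interior_of (F \<inter> Y i) \<noteq> {}"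
  proof (rule ccontr)
    assume "\<not> ?thesis"
    then have "?S interior_of \<Union>((\<lambda>i. F \<inter> Y i) ` I) = {}"
      using assms
      by (intro Baire_category_alt)
        (auto simp: closedin_subtopology_Int_closed Hausdorff_space_subtopology
          locally_compact_Hausdorff_imp_regular_space)
    moreover have "\<Union>((\<lambda>i. F \<inter> Y i) ` I) = topspace ?S"
      using assms by auto
    ultimately show False
      using assms by (metis inf.absorb2 interior_of_topspace topspace_subtopology)
  qed
  then obtain i where i: "i \<in> I" "?S interior_of (F \<inter> Y i) \<noteq> {}"
    by blast
  obtain W where W: "openin X W" "?S interior_of (F \<inter> Y i) = W \<inter> F"
    by (metis openin_interior_of openin_subtopology)
  show thesis
    using that[OF i(1) W(1)] W(2) i(2) interior_of_subset[of ?S "F \<inter> Y i"] by auto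
qed

theorem theorem3p2:
  fixes X :: "'a topology" and I :: "'i set" and Y :: "'i \<Rightarrow> 'a set"
  assumes "connected_space X"
    and "locally_connected_space X"
    and "Hausdorff_space X"
    and "locally_compact_space X"
    and "countable I"
    and "I \<noteq> {}"
    and "\<And>i. i \<in> I \<Longrightarrow> closedin X (Y i)"
    and "(\<Union>i\<in>I. Y i) = topspace X"
    and "\<And>i j. i \<in> I \<Longrightarrow> j \<in> I \<Longrightarrow> i \<noteq> j \<Longrightarrow> small_in X (Y i \<inter> Y j)"
  shows "\<exists>i\<in>I. Y i = topspace X"
proof -
  define G where "G i = X interior_of Y i" for i
  define F where "F = topspace X - (\<Union>i\<in>I. G i)"
  have G_open: "openin X (G i)" and G_sub: "G i \<subseteq> Y i" for i
    by (auto simp: G_def interior_of_subset)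
  have Y_sub: "Y i \<subseteq> topspace X" if "i \<in> I" for i
    using assms(7) that closedin_subset by blast
  have G_disj: "G i \<inter> G j = {}" if "i \<in> I" "j \<in> I" "i \<noteq> j" for i j
  proof -
    have "G i \<inter> G j = X interior_of (Y i \<inter> Y j)"
      by (simp add: G_def interior_of_Int)
    then show ?thesis
      using assms(9)[OF that] by (simp add: small_in_def)
  qed
  have dense: "\<exists>j\<in>I. G j \<inter> V \<noteq> {}" if V: "openin X V" "V \<noteq> {}" for V
  proof -
    have "locally_compact_space (subtopology X V)"
      using assms V
      by (simp add: locally_compact_space_open_subset locally_compact_Hausdorff_imp_regular_space)
    then obtain i W where W: "i \<in> I" "openin X W" "W \<inter> V \<noteq> {}" "W \<inter> V \<subseteq> Y i"
      using countable_closed_cover_relative_interior[of X V I Y] assms V openin_subset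
      by metis
    \<comment> \<open>As \<open>V\<close> is open, a relatively open subset of \<open>V\<close> is
      open in \<open>X\<close>.\<close>
    then have "W \<inter> V \<subseteq> G i"
      unfolding G_def using V by (intro interior_of_maximal) auto
    then show ?thesis
      using W by blast
  qed
  show ?thesis
  proof (cases "F = {}")
    case True
    then have cover: "topspace X = (\<Union>i\<in>I. G i)"
      using Y_sub G_sub by (fastforce simp: F_def)
    show ?thesis
    proof (cases "topspace X = {}")
      case True
      then show ?thesis
        using assms(6) Y_sub by fastforce
    next
      case False
      then obtain i where i: "i \<in> I" "G i \<noteq> {}"
        using cover by auto
      \<comment> \<open>The complement of \<open>G i\<close> is a union of open sets, so
        \<open>G i\<close> is clopen.\<close>
      have "topspace X - G i = (\<Union>j\<in>I - {i}. G j)"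
        using G_disj i cover by fastforce
      then have "closedin X (G i)"
        using G_open openin_subset by (fastforce simp: closedin_def)
      then have "G i = topspace X"
        using assms(1) i G_open by (auto simp: connected_space_clopen_in)
      then show ?thesis
        using i G_sub Y_sub by blast
    qed
  next
    case False
    have "closedin X F"
      using G_open by (auto simp: F_def)
    then have "locally_compact_space (subtopology X F)" "F \<subseteq> topspace X"
      using assms(4) by (auto simp: locally_compact_space_closed_subset F_def)
    then obtain i W where i: "i \<in> I" and W: "openin X W" "W \<inter> F \<noteq> {}" "W \<inter> F \<subseteq> Y i"
      using countable_closed_cover_relative_interior[of X F I Y] assms False by metis
    then obtain x where x: "x \<in> W" "x \<in> F"
      by blast
    then obtain U where U: "openin X U" "connectedin X U" "x \<in> U" "U \<subseteq> W"
      using assms(2) W by (meson locally_connected_space)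
    \<comment> \<open>An open \<open>U\<close> inside \<open>Y j\<close> would lie in
      \<open>G j\<close>, but \<open>x \<in> F\<close> lies in no \<open>G j\<close>.\<close>
    have U_not_sub: "\<not> U \<subseteq> Y j" if "j \<in> I" for j
      using interior_of_maximal[of U "Y j" X] U x that by (auto simp: F_def G_def)
    have "openin X (U - Y i)"
      using U assms(7) i by blast
    then obtain j where j: "j \<in> I" "G j \<inter> (U - Y i) \<noteq> {}"
      using dense U_not_sub[OF i] by blast
    then have "j \<noteq> i"
      using G_sub by blast
    let ?S = "U - Y i \<inter> Y j"
    \<comment> \<open>The points of \<open>X\<close> outside \<open>G j \<union> ?E\<close> are
      exactly those of \<open>F \<inter> Y j\<close>. Within \<open>U\<close> they lie in
      \<open>Y i\<close> as well, so \<open>?S\<close> omits them, and the open sets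
      \<open>G j\<close> and \<open>?E\<close> separate \<open>?S\<close>.\<close>
    let ?E = "(topspace X - Y j) \<union> (\<Union>k\<in>I - {j}. G k)"
    have "connectedin X ?S"
      using assms(9)[OF i j(1)] \<open>j \<noteq> i\<close> U by (auto simp: small_in_def locally_disconnects_def)
    moreover have "openin X ?E"
      using assms(7)[OF j(1)] G_open by auto
    moreover have "?S \<subseteq> G j \<union> ?E"
    proof
      fix y assume y: "y \<in> ?S"
      then have "y \<in> F \<Longrightarrow> y \<notin> Y j"
        using U(4) W(3) by blast
      then show "y \<in> G j \<union> ?E"
        using y openin_subset[OF U(1)] by (auto simp: F_def)
    qed
    moreover have "G j \<inter> ?E \<inter> ?S = {}"
      using G_disj[OF j(1)] G_sub by blast
    \<comment> \<open>Both pieces are nonempty: a point of \<open>U\<close> outside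
      \<open>Y i\<close> or outside \<open>Y j\<close> survives the removal of
      \<open>Y i \<inter> Y j\<close>.\<close>
    moreover have "G j \<inter> ?S \<noteq> {}"
      using j by blast
    moreover have "?E \<inter> ?S \<noteq> {}"
      using U_not_sub[OF j(1)] openin_subset[OF U(1)] by blast
    ultimately have False
      by (rule connectedinD[OF _ G_open])
    then show ?thesis ..
  qed
qed

end
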